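(* In Regime J, let $\bar a(\beta_J,q)$ be the critical verification level as a function of the audit effort $\beta_J$ and the informativeness $q$ of the private signal $s$, and let $\beta_J(q)$ be the equilibrium audit effort as a function of $q$. Then: 1. Keeping $\beta_J$ constant, the critical verification level increases in the informativeness of $s$: $\dfrac{\partial \bar a(\beta_J,q)}{\partial q}>0$. 2. The auditor's effort increases in $q$: $\dfrac{d\beta_J(q)}{dq}>0$. 3. The critical verification level increases in $q$: $\dfrac{d\bar a(\beta_J(q),q)}{dq}>0$.
   Context: A state $\theta\in\{G,B\}$ has $\Pr(\theta=G)=\Pr(\theta=B)=1/2$. Parameters satisfy $c>I>0$ and $k>L>0$; put $i=I/c$ (verification incentive) and $l=L/k$ (audit incentive). Private signal: the signal $s$ about $\theta$ has finite support (realizations denoted $\omega_t$) and belongs to a continuous nested family of information structures $\{\pi_q\}_{q\in[0,1]}$. The parameter $q$ indexes informativeness: whenever $q'>q$, $\pi_{q'}$ strictly Blackwell dominates $\pi_q$; $\pi_0$ is uninformative, $\pi_1$ is perfectly informative, and the conditional signal distributions $\Pr_q(s=\omega_t\mid\theta)$ vary continuously in $q$. Regime J: an auditor with effort $\beta$ (cost $\frac12k\beta^2$) issues a report $r\in\{g,b\}$ with $\Pr(r=g\mid G)=1$ and $\Pr(r=g\mid B)=1-\beta$; $r$ and $s$ are independent conditional on $\theta$. After observing $(r=g,s=\omega_t)$, the stakeholder chooses a verification level $a$ (the probability of identifying the state) at cost $\frac12ca^2$; an undetected bad state costs him $I$, and a bad state detected after $r=g$ costs the auditor $L$. Given anticipated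 effort $\beta_J$, the stakeholder's optimal verification level is $a(\omega_t)=i\Pr(\theta=B\mid r=g,s=\omega_t)$. The critical verification level is its expectation conditional on $\theta=B$ and $r=g$: $$\bar a(\beta_J,q)=\sum_t\Pr\nolimits_q(s=\omega_t\mid B)\,a(\omega_t)=i\sum_t\frac{(1-\beta_J)[\Pr_q(s=\omega_t\mid B)]^2}{(1-\beta_J)\Pr_q(s=\omega_t\mid B)+\Pr_q(s=\omega_t\mid G)},$$ the sum being over the support of $s$. The equilibrium is unique, and the equilibrium effort $\beta_J(q)$ is the unique solution $\beta\in[0,1)$ of $\beta=\frac l2\,\bar a(\beta,q)$.
   Formalization: The derivatives in q may fail to exist or be zero at some q, so claims 1–3 are stated as strict increase in q on [0,1]; positive derivatives in claims 2 and 3 are asserted at each q where ∂ā/∂q at (β_J(q),q) exists and is positive. *)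

theory Defs
  imports "HOL-Probability.Probability"
begin

datatype state = Good | Bad
datatype report = Good_Report | Bad_Report

text \<open>An information structure: a conditional signal distribution for each state.\<close>
type_synonym 'w info = "state \<Rightarrow> 'w pmf"

text \<open>\<open>E'\<close> dominates \<open>E\<close> if \<open>E\<close> is obtained from \<open>E'\<close> by a state-independent garbling.\<close>
definition blackwell_dominates :: "'v info \<Rightarrow> 'w info \<Rightarrow> bool" where
  "blackwell_dominates E' E \<longleftrightarrow>
     (\<exists>garbling :: 'v \<Rightarrow> 'w pmf. \<forall>\<theta>. E \<theta> = bind_pmf (E' \<theta>) garbling)"

definition strictly_blackwell_dominates :: "'v info \<Rightarrow> 'w info \<Rightarrow> bool" where
  "strictly_blackwell_dominates E' E \<longleftrightarrow>
     blackwell_dominates E' E \<and> \<not> blackwell_dominates E E'"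

definition uninformative :: "'w info \<Rightarrow> bool" where
  "uninformative E \<longleftrightarrow> E Good = E Bad"

definition perfectly_informative :: "'w info \<Rightarrow> bool" where
  "perfectly_informative E \<longleftrightarrow> set_pmf (E Good) \<inter> set_pmf (E Bad) = {}"

definition signal_support :: "'w info \<Rightarrow> 'w set" where
  "signal_support E = set_pmf (E Good) \<union> set_pmf (E Bad)"

definition nested_signal_family :: "(real \<Rightarrow> 'w info) \<Rightarrow> bool" where
  "nested_signal_family \<pi> \<longleftrightarrow>
     (\<forall>q\<in>{0..1}. finite (signal_support (\<pi> q))) \<and>
     (\<forall>q\<in>{0..1}. \<forall>q'\<in>{0..1}. q < q' \<longrightarrow> strictly_blackwell_dominates (\<pi> q') (\<pi> q)) \<and>
     uninformative (\<pi> 0) \<and> perfectly_informative (\<pi> 1) \<and>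
     (\<forall>\<theta> \<omega>. continuous_on {0..1} (\<lambda>q. pmf (\<pi> q \<theta>) \<omega>))"

fun report_pmf :: "real \<Rightarrow> state \<Rightarrow> report pmf" where
  "report_pmf \<beta> Good = return_pmf Good_Report"
| "report_pmf \<beta> Bad =
     map_pmf (\<lambda>found. if found then Bad_Report else Good_Report) (bernoulli_pmf \<beta>)"

text \<open>Joint law of state, report and signal: uniform prior, with report and signal
  independent conditional on the state.\<close>
definition joint_pmf :: "real \<Rightarrow> 'w info \<Rightarrow> (state \<times> report \<times> 'w) pmf" where
  "joint_pmf \<beta> E =
     bind_pmf (pmf_of_set {Good, Bad}) (\<lambda>\<theta>.
       map_pmf (Pair \<theta>) (pair_pmf (report_pmf \<beta> \<theta>) (E \<theta>)))"

definition posterior_bad :: "real \<Rightarrow> 'w info \<Rightarrow> 'w \<Rightarrow> real" where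
  "posterior_bad \<beta> E \<omega> =
     \<P>(x in measure_pmf (joint_pmf \<beta> E).
        fst x = Bad \<bar> fst (snd x) = Good_Report \<and> snd (snd x) = \<omega>)"

definition verification :: "real \<Rightarrow> real \<Rightarrow> 'w info \<Rightarrow> 'w \<Rightarrow> real" where
  "verification i \<beta> E \<omega> = i * posterior_bad \<beta> E \<omega>"

text \<open>Conditional on the bad state the report does not affect the law of the signal, so the
  conditional expectation given a bad state and a good report weights signals by \<open>E Bad\<close>.\<close>
definition critical_verification :: "real \<Rightarrow> real \<Rightarrow> 'w info \<Rightarrow> real" where
  "critical_verification i \<beta> E =
     (\<Sum>\<omega>\<in>signal_support E. pmf (E Bad) \<omega> * verification i \<beta> E \<omega>)"

definition equilibrium_effort :: "real \<Rightarrow> real \<Rightarrow> 'w info \<Rightarrow> real" where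
  "equilibrium_effort i l E =
     (THE \<beta>. 0 \<le> \<beta> \<and> \<beta> < 1 \<and> \<beta> = l / 2 * critical_verification i \<beta> E)"

lemma pmf_joint:
  assumes "0 \<le> \<beta>" "\<beta> \<le> 1"
  shows "pmf (joint_pmf \<beta> E) (Bad, Good_Report, \<omega>) = (1 - \<beta>) * pmf (E Bad) \<omega> / 2"
    and "pmf (joint_pmf \<beta> E) (Good, Good_Report, \<omega>) = pmf (E Good) \<omega> / 2"
proof -
  have inj: "inj (Pair \<theta>)" for \<theta> :: state
    by (auto simp: inj_def)
  have off: "pmf (map_pmf (Pair \<theta>) p) (\<theta>', y) = 0" if "\<theta> \<noteq> \<theta>'"
    for \<theta> \<theta>' :: state and p and y :: "report \<times> 'a"
    using that by (auto simp: pmf_eq_0_set_pmf)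
  have on: "pmf (map_pmf (Pair \<theta>) p) (\<theta>, y) = pmf p y"
    for \<theta> :: state and p and y :: "report \<times> 'a"
    by (rule pmf_map_inj'[OF inj])
  have rep: "pmf (report_pmf \<beta> Bad) Good_Report = 1 - \<beta>"
  proof -
    have "(\<lambda>found. if found then Bad_Report else Good_Report) -` {Good_Report} = {False}"
      by (auto split: if_splits)
    then show ?thesis
      using assms by (simp add: pmf_map measure_pmf_single)
  qed
  show "pmf (joint_pmf \<beta> E) (Bad, Good_Report, \<omega>) = (1 - \<beta>) * pmf (E Bad) \<omega> / 2"
    unfolding joint_pmf_def
    by (simp add: pmf_bind integral_pmf_of_set off on pmf_pair rep del: report_pmf.simps)
  show "pmf (joint_pmf \<beta> E) (Good, Good_Report, \<omega>) = pmf (E Good) \<omega> / 2"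
    unfolding joint_pmf_def
    by (simp add: pmf_bind integral_pmf_of_set off on pmf_pair)
qed

lemma posterior_bad_eq:
  assumes "0 \<le> \<beta>" "\<beta> \<le> 1"
  shows "posterior_bad \<beta> E \<omega> =
    (1 - \<beta>) * pmf (E Bad) \<omega> / ((1 - \<beta>) * pmf (E Bad) \<omega> + pmf (E Good) \<omega>)"
proof -
  have num: "{x. fst x = Bad \<and> fst (snd x) = Good_Report \<and> snd (snd x) = \<omega>} =
      {(Bad, Good_Report, \<omega>)}"
    by auto
  have den: "{x :: state \<times> report \<times> 'a. fst (snd x) = Good_Report \<and> snd (snd x) = \<omega>} =
      {(Bad, Good_Report, \<omega>), (Good, Good_Report, \<omega>)}" (is "?A = ?B")
  proof (rule set_eqI)
    fix x :: "state \<times> report \<times> 'a"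
    show "x \<in> ?A \<longleftrightarrow> x \<in> ?B"
      by (cases x; cases "fst x") auto
  qed
  show ?thesis
    unfolding posterior_bad_def cond_prob_def
    by (simp add: num den measure_pmf_single measure_measure_pmf_finite pmf_joint[OF assms]
        add_divide_distrib[symmetric])
qed

lemma critical_verification_eq:
  assumes "0 \<le> \<beta>" "\<beta> \<le> 1"
  shows "critical_verification i \<beta> E =
    i * (\<Sum>\<omega>\<in>signal_support E. (1 - \<beta>) * (pmf (E Bad) \<omega>)\<^sup>2 /
                                 ((1 - \<beta>) * pmf (E Bad) \<omega> + pmf (E Good) \<omega>))"
  unfolding critical_verification_def verification_def posterior_bad_eq[OF assms] sum_distrib_left
  by (intro sum.cong refl) (simp add: power2_eq_square algebra_simps)

end

theory Submission
  imports Defs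
begin

text \<open>
  With \<open>x = 1 - \<beta>\<close>, \<open>b\<close>, \<open>g\<close> the signal weights in the two states and \<open>n = x b + g\<close>, the critical
  verification level is \<open>i/x\<close> times the sum of \<open>(x b)\<^sup>2 / n\<close>. A garbling lowers this sum by a
  weighted variance of the ratio \<open>x b / n\<close>; if nothing is lost, the ratio is constant along the
  garbling, so Bayes' rule inverts the garbling and the domination is not strict.

  For fixed signal the level has nonpositive difference quotients \<open>- i \<Sum> b\<^sup>2 g / (n n\<^sub>0)\<close> in \<open>\<beta>\<close>, so the
  effort is unique and inherits monotonicity in \<open>q\<close>. Solving the increment of the equilibrium
  equation for the increment of the effort also gives its derivative, without the implicit function
  theorem: signals outside the finite support at the base point carry vanishing probability, so the
  difference quotients converge although the support may vary with \<open>q\<close>.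
\<close>

section \<open>Strict increase of the critical level under Blackwell domination\<close>

text \<open>For each \<open>w\<close>, the quotient \<open>h w / n w\<close> is the mean of
  \<open>h' v / n' v\<close> under the weights \<open>n' v * K v w / n w\<close>, so expanding the
  square leaves second moment minus squared mean. An exact identity is kept instead of Jensen's
  inequality because strictness needs the equality case.\<close>

lemma sum_square_quotient_garbling:
  fixes h' n' :: "'v \<Rightarrow> real" and h n :: "'w \<Rightarrow> real"
  assumes V: "finite V" "\<And>v. v \<in> V \<Longrightarrow> n' v > 0" "\<And>v. v \<in> V \<Longrightarrow> (\<Sum>w\<in>W. K v w) = 1"
    and W: "\<And>w. w \<in> W \<Longrightarrow> n w > 0"
    and h: "\<And>w. w \<in> W \<Longrightarrow> h w = (\<Sum>v\<in>V. h' v * K v w)"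
    and n: "\<And>w. w \<in> W \<Longrightarrow> n w = (\<Sum>v\<in>V. n' v * K v w)"
  shows "(\<Sum>v\<in>V. (h' v)\<^sup>2 / n' v) - (\<Sum>w\<in>W. (h w)\<^sup>2 / n w) =
    (\<Sum>w\<in>W. \<Sum>v\<in>V. K v w * n' v * (h' v / n' v - h w / n w)\<^sup>2)"
proof -
  have inner: "(\<Sum>v\<in>V. K v w * n' v * (h' v / n' v - h w / n w)\<^sup>2) =
      (\<Sum>v\<in>V. (h' v)\<^sup>2 / n' v * K v w) - (h w)\<^sup>2 / n w" if w: "w \<in> W" for w
  proof -
    have "(\<Sum>v\<in>V. K v w * n' v * (h' v / n' v - h w / n w)\<^sup>2) =
        (\<Sum>v\<in>V. (h' v)\<^sup>2 / n' v * K v w - 2 * (h w / n w) * (h' v * K v w)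
               + (h w / n w)\<^sup>2 * (n' v * K v w))"
    proof (rule sum.cong[OF refl])
      fix v assume "v \<in> V"
      then have "n' v \<noteq> 0" using V(2) by force
      then show "K v w * n' v * (h' v / n' v - h w / n w)\<^sup>2 =
          (h' v)\<^sup>2 / n' v * K v w - 2 * (h w / n w) * (h' v * K v w) + (h w / n w)\<^sup>2 * (n' v * K v w)"
        by (simp add: power2_diff power_divide power2_eq_square[of "n' v"] algebra_simps)
    qed
    also have "\<dots> = (\<Sum>v\<in>V. (h' v)\<^sup>2 / n' v * K v w) - 2 * (h w / n w) * h w + (h w / n w)\<^sup>2 * n w"
      by (simp only: sum.distrib sum_subtractf sum_distrib_left[symmetric] h[OF w] n[OF w])
    also have "\<dots> = (\<Sum>v\<in>V. (h' v)\<^sup>2 / n' v * K v w) - (h w)\<^sup>2 / n w"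
      using W[OF w] by (simp add: field_simps power2_eq_square)
    finally show ?thesis .
  qed
  have "(\<Sum>w\<in>W. \<Sum>v\<in>V. (h' v)\<^sup>2 / n' v * K v w) = (\<Sum>v\<in>V. (h' v)\<^sup>2 / n' v * (\<Sum>w\<in>W. K v w))"
    by (subst sum.swap) (simp add: sum_distrib_left)
  also have "\<dots> = (\<Sum>v\<in>V. (h' v)\<^sup>2 / n' v)"
    using V(3) by simp
  finally show ?thesis
    by (simp add: inner sum_subtractf)
qed

lemma pmf_bind_finite:
  assumes "finite A" "set_pmf p \<subseteq> A"
  shows "pmf (bind_pmf p f) y = (\<Sum>a\<in>A. pmf p a * pmf (f a) y)"
  unfolding pmf_bind
  by (subst integral_measure_pmf_real[of A]) (use assms in \<open>auto simp: mult.commute\<close>)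

lemma pmf_embed_pmf_finite:
  assumes "finite A" "\<And>v. v \<in> A \<Longrightarrow> 0 \<le> f v" "(\<Sum>v\<in>A. f v) = 1"
  shows "pmf (embed_pmf (\<lambda>v. if v \<in> A then f v else 0)) v = (if v \<in> A then f v else 0)"
proof (rule pmf_embed_pmf)
  show "0 \<le> (if v \<in> A then f v else 0)" for v
    using assms(2) by simp
  have "(\<integral>\<^sup>+v. ennreal (if v \<in> A then f v else 0) \<partial>count_space UNIV) =
      (\<Sum>v\<in>A. ennreal (if v \<in> A then f v else 0))"
    by (rule nn_integral_count_space') (use assms(1) in auto)
  also have "\<dots> = ennreal (\<Sum>v\<in>A. f v)"
    using assms(2) by (simp add: sum_ennreal)
  finally show "(\<integral>\<^sup>+v. ennreal (if v \<in> A then f v else 0) \<partial>count_space UNIV) = 1"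
    by (simp add: assms(3))
qed

lemma set_pmf_subset_signal_support: "set_pmf (E \<theta>) \<subseteq> signal_support E"
  by (cases \<theta>) (auto simp: signal_support_def)

text \<open>A supported signal has positive probability in at least one state. With \<open>x\<close>
  standing for 1 - \<beta>, this keeps every denominator nonzero for effort below 1.\<close>

lemma weight_pos:
  assumes "\<omega> \<in> signal_support E" "0 < x"
  shows "0 < x * pmf (E Bad) \<omega> + pmf (E Good) \<omega>"
proof (cases "\<omega> \<in> set_pmf (E Bad)")
  case True
  then show ?thesis
    using assms(2) by (intro add_pos_nonneg mult_pos_pos) (auto simp: pmf_positive)
next
  case False
  then have "\<omega> \<in> set_pmf (E Good)"
    using assms(1) by (auto simp: signal_support_def)
  then show ?thesis
    using assms(2) by (intro add_nonneg_pos mult_nonneg_nonneg) (auto simp: pmf_positive)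
qed

text \<open>If both states have densities relative to \<open>n'\<close> that are constant along
  \<open>K\<close>, the law of \<open>v\<close> given \<open>w\<close> is the same in both states.
  This common Bayes posterior is then a garbling that recovers \<open>E'\<close> from
  \<open>E\<close>.\<close>

lemma blackwell_dominates_reverse:
  fixes E' :: "'v info" and E :: "'w info"
  assumes fin: "finite V" "finite W" and sub: "\<And>\<theta>. set_pmf (E' \<theta>) \<subseteq> V" "\<And>\<theta>. set_pmf (E \<theta>) \<subseteq> W"
    and K: "\<And>v w. v \<in> V \<Longrightarrow> w \<in> W \<Longrightarrow> 0 \<le> K v w" "\<And>v. v \<in> V \<Longrightarrow> (\<Sum>w\<in>W. K v w) = 1"
    and n: "\<And>v. v \<in> V \<Longrightarrow> 0 < n' v" "\<And>w. w \<in> W \<Longrightarrow> 0 < n w"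
      "\<And>w. w \<in> W \<Longrightarrow> n w = (\<Sum>v\<in>V. n' v * K v w)"
    and ratio: "\<And>\<theta> v w. v \<in> V \<Longrightarrow> w \<in> W \<Longrightarrow> K v w \<noteq> 0 \<Longrightarrow>
      pmf (E' \<theta>) v / n' v = pmf (E \<theta>) w / n w"
  shows "blackwell_dominates E E'"
proof -
  \<comment> \<open>The Bayes posterior of \<open>v\<close> given \<open>w\<close>. For
    \<open>w\<close> outside \<open>W\<close> the value of \<open>embed_pmf\<close> is unspecified,
    which is harmless because \<open>E \<theta>\<close> puts no mass there.\<close>
  define R where "R w = embed_pmf (\<lambda>v. if v \<in> V then n' v * K v w / n w else 0)" for w
  have R: "pmf (R w) v = (if v \<in> V then n' v * K v w / n w else 0)" if w: "w \<in> W" for v w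
    unfolding R_def
  proof (rule pmf_embed_pmf_finite[OF fin(1)])
    show "0 \<le> n' v * K v w / n w" if "v \<in> V" for v
      using K(1)[OF that w] n(1)[OF that] n(2)[OF w] by simp
    have "(\<Sum>v\<in>V. n' v * K v w / n w) = n w / n w"
      by (simp only: n(3)[OF w] sum_divide_distrib[symmetric])
    then show "(\<Sum>v\<in>V. n' v * K v w / n w) = 1"
      using n(2)[OF w] by simp
  qed
  have "pmf (bind_pmf (E \<theta>) R) v = pmf (E' \<theta>) v" for \<theta> v
  proof (cases "v \<in> V")
    case True
    have "pmf (bind_pmf (E \<theta>) R) v = (\<Sum>w\<in>W. pmf (E \<theta>) w * (n' v * K v w / n w))"
      using True by (simp add: pmf_bind_finite[OF fin(2) sub(2)] R)
    also have "\<dots> = (\<Sum>w\<in>W. pmf (E' \<theta>) v * K v w)"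
    proof (rule sum.cong[OF refl])
      fix w assume w: "w \<in> W"
      show "pmf (E \<theta>) w * (n' v * K v w / n w) = pmf (E' \<theta>) v * K v w"
        using ratio[OF True w, of \<theta>] n(1)[OF True] n(2)[OF w]
        by (cases "K v w = 0") (auto simp: field_simps)
    qed
    also have "\<dots> = pmf (E' \<theta>) v"
      using K(2)[OF True] by (simp add: sum_distrib_left[symmetric])
    finally show ?thesis .
  next
    case False
    then have "pmf (E' \<theta>) v = 0"
      using sub(1)[of \<theta>] by (auto simp: pmf_eq_0_set_pmf)
    with False show ?thesis
      by (simp add: pmf_bind_finite[OF fin(2) sub(2)] R)
  qed
  then have "E' \<theta> = bind_pmf (E \<theta>) R" for \<theta>
    by (intro pmf_eqI) simp
  then show ?thesis
    unfolding blackwell_dominates_def by blast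
qed

text \<open>Pulling out 1/(1 - \<beta>) makes each numerator the square of a summand of its
  denominator, the shape to which the variance identity applies.\<close>

lemma critical_verification_eq_squares:
  assumes "0 \<le> \<beta>" "\<beta> < 1"
  shows "critical_verification i \<beta> E = i / (1 - \<beta>) *
    (\<Sum>\<omega>\<in>signal_support E. ((1 - \<beta>) * pmf (E Bad) \<omega>)\<^sup>2 /
                             ((1 - \<beta>) * pmf (E Bad) \<omega> + pmf (E Good) \<omega>))"
proof -
  have "critical_verification i \<beta> E = i * (\<Sum>\<omega>\<in>signal_support E. 1 / (1 - \<beta>) *
     (((1 - \<beta>) * pmf (E Bad) \<omega>)\<^sup>2 / ((1 - \<beta>) * pmf (E Bad) \<omega> + pmf (E Good) \<omega>)))"
    using assms by (simp add: critical_verification_eq power_mult_distrib power2_eq_square[of "1 - \<beta>"] mult.assoc)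
  then show ?thesis
    by (simp only: sum_distrib_left[symmetric]) simp
qed

lemma critical_verification_strict_mono:
  fixes E :: "'w info" and E' :: "'v info"
  assumes fin': "finite (signal_support E')" and fin: "finite (signal_support E)"
    and dom: "strictly_blackwell_dominates E' E"
    and \<beta>: "0 \<le> \<beta>" "\<beta> < 1" and i: "0 < i"
  shows "critical_verification i \<beta> E < critical_verification i \<beta> E'"
proof -
  obtain garb where garb: "\<And>\<theta>. E \<theta> = bind_pmf (E' \<theta>) garb"
    using dom unfolding strictly_blackwell_dominates_def blackwell_dominates_def by blast
  define V W x where "V = signal_support E'" and "W = signal_support E" and "x = 1 - \<beta>"
  define K where "K v w = pmf (garb v) w" for v w
  define h' n' where "h' v = x * pmf (E' Bad) v" and "n' v = h' v + pmf (E' Good) v" for v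
  define h n where "h w = x * pmf (E Bad) w" and "n w = h w + pmf (E Good) w" for w
  have x: "x > 0" using \<beta> by (simp add: x_def)
  have finV: "finite V" and finW: "finite W" using fin fin' by (auto simp: V_def W_def)
  have n'_pos: "n' v > 0" if "v \<in> V" for v
    using weight_pos[of v E' x] that x by (simp add: V_def n'_def h'_def)
  have n_pos: "n w > 0" if "w \<in> W" for w
    using weight_pos[of w E x] that x by (simp add: W_def n_def h_def)
  have K1: "(\<Sum>w\<in>W. K v w) = 1" if "v \<in> V" for v
    unfolding K_def
  proof (rule sum_pmf_eq_1[OF finW])
    \<comment> \<open>Each \<open>v\<close> in \<open>V\<close> occurs in some state, so every
      outcome of \<open>garb v\<close> is a signal of \<open>E\<close> in that state.\<close>
    show "set_pmf (garb v) \<subseteq> W"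
      using that by (auto simp: V_def W_def signal_support_def garb)
  qed
  have push: "pmf (E \<theta>) w = (\<Sum>v\<in>V. pmf (E' \<theta>) v * K v w)" for \<theta> w
    unfolding garb K_def V_def by (rule pmf_bind_finite[OF fin' set_pmf_subset_signal_support])
  have h_eq: "h w = (\<Sum>v\<in>V. h' v * K v w)" for w
    by (simp add: h_def h'_def push sum_distrib_left mult.assoc)
  have n_eq: "n w = (\<Sum>v\<in>V. n' v * K v w)" for w
    by (simp add: n_def n'_def h_eq push[of Good] sum.distrib distrib_right)
  let ?gain = "\<lambda>w v. K v w * n' v * (h' v / n' v - h w / n w)\<^sup>2"
  have gap: "(\<Sum>v\<in>V. (h' v)\<^sup>2 / n' v) - (\<Sum>w\<in>W. (h w)\<^sup>2 / n w) = (\<Sum>w\<in>W. \<Sum>v\<in>V. ?gain w v)"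
    using finV n'_pos K1 n_pos h_eq n_eq by (rule sum_square_quotient_garbling)
  have gain_nonneg: "0 \<le> ?gain w v" if "v \<in> V" for v w
    using n'_pos[OF that] by (simp add: K_def)
  have "(\<Sum>w\<in>W. \<Sum>v\<in>V. ?gain w v) \<noteq> 0"
  proof
    assume "(\<Sum>w\<in>W. \<Sum>v\<in>V. ?gain w v) = 0"
    then have zero: "?gain w v = 0" if "v \<in> V" "w \<in> W" for v w
      using that gain_nonneg
      by (simp add: sum_nonneg_eq_0_iff[OF finW] sum_nonneg_eq_0_iff[OF finV] sum_nonneg)
    have "blackwell_dominates E E'"
    proof (rule blackwell_dominates_reverse[OF finV finW])
      show "set_pmf (E' \<theta>) \<subseteq> V" "set_pmf (E \<theta>) \<subseteq> W" for \<theta>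
        unfolding V_def W_def by (rule set_pmf_subset_signal_support)+
      show "pmf (E' \<theta>) v / n' v = pmf (E \<theta>) w / n w" if v: "v \<in> V" and w: "w \<in> W" and "K v w \<noteq> 0"
        for \<theta> v w
      proof -
        have eq: "h' v / n' v = h w / n w"
          using zero[OF v w] n'_pos[OF v] that by auto
        \<comment> \<open>The variance only controls the ratio of the bad state; since the two
          summands of \<open>n'\<close> and of \<open>n\<close> add up to the whole, it fixes the
          ratio of the good state as well.\<close>
        moreover have "pmf (E' Good) v / n' v = 1 - h' v / n' v" "pmf (E Good) w / n w = 1 - h w / n w"
          using n'_pos[OF v] n_pos[OF w] by (auto simp: n'_def n_def field_simps)
        ultimately show ?thesis
          using x by (cases \<theta>) (simp_all add: h'_def h_def flip: times_divide_eq_right)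
      qed
    qed (use K1 n'_pos n_pos n_eq in \<open>auto simp: K_def\<close>)
    then show False
      using dom by (simp add: strictly_blackwell_dominates_def)
  qed
  moreover have "(\<Sum>w\<in>W. \<Sum>v\<in>V. ?gain w v) \<ge> 0"
    by (intro sum_nonneg gain_nonneg)
  ultimately have "(\<Sum>w\<in>W. (h w)\<^sup>2 / n w) < (\<Sum>v\<in>V. (h' v)\<^sup>2 / n' v)"
    using gap by linarith
  then show ?thesis
    using i x unfolding critical_verification_eq_squares[OF \<beta>]
    by (intro mult_strict_left_mono)
       (auto simp: V_def W_def x_def h_def h'_def n_def n'_def)
qed

section \<open>Dependence on effort, and existence, uniqueness and monotonicity of the
  equilibrium\<close>

text \<open>The level is an average of \<open>i\<close> times a posterior probability. The bounds
  supply the signs at the endpoints for the intermediate value theorem.\<close>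

lemma critical_verification_bounds:
  assumes fin: "finite (signal_support E)" and \<beta>: "0 \<le> \<beta>" "\<beta> \<le> 1" and i: "0 \<le> i"
  shows "0 \<le> critical_verification i \<beta> E" "critical_verification i \<beta> E \<le> i"
proof -
  have post: "0 \<le> posterior_bad \<beta> E \<omega>" "posterior_bad \<beta> E \<omega> \<le> 1" for \<omega>
  proof -
    have "0 \<le> (1 - \<beta>) * pmf (E Bad) \<omega>" using \<beta> by simp
    then show "0 \<le> posterior_bad \<beta> E \<omega>" "posterior_bad \<beta> E \<omega> \<le> 1"
      using pmf_nonneg[of "E Good" \<omega>] \<beta>
      by (auto simp: posterior_bad_eq divide_le_eq_1 simp del: pmf_nonneg)
  qed
  show "0 \<le> critical_verification i \<beta> E"
    unfolding critical_verification_def verification_def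
    using post i by (intro sum_nonneg mult_nonneg_nonneg) auto
  have "critical_verification i \<beta> E \<le> (\<Sum>\<omega>\<in>signal_support E. pmf (E Bad) \<omega> * i)"
    unfolding critical_verification_def verification_def
    using post i by (intro sum_mono mult_left_mono mult_left_le) auto
  also have "\<dots> = i"
    by (simp add: sum_distrib_right[symmetric] sum_pmf_eq_1[OF fin set_pmf_subset_signal_support])
  finally show "critical_verification i \<beta> E \<le> i" .
qed

text \<open>For efforts in [0,1), minus \<open>i\<close> times this is the difference quotient of
  the level in effort; at \<beta> = \<open>\<beta>\<^sub>0\<close> it becomes the partial
  derivative. Keeping both efforts allows exact increments without differentiating in
  effort.\<close>

definition verification_slope :: "real \<Rightarrow> real \<Rightarrow> 'w info \<Rightarrow> real" where
  "verification_slope \<beta>\<^sub>0 \<beta> E =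
     (\<Sum>\<omega>\<in>signal_support E. (pmf (E Bad) \<omega>)\<^sup>2 * pmf (E Good) \<omega> /
        (((1 - \<beta>) * pmf (E Bad) \<omega> + pmf (E Good) \<omega>) * ((1 - \<beta>\<^sub>0) * pmf (E Bad) \<omega> + pmf (E Good) \<omega>)))"

lemma verification_slope_nonneg:
  assumes "\<beta>\<^sub>0 \<le> 1" "\<beta> \<le> 1"
  shows "0 \<le> verification_slope \<beta>\<^sub>0 \<beta> E"
  unfolding verification_slope_def using assms
  by (intro sum_nonneg divide_nonneg_nonneg mult_nonneg_nonneg add_nonneg_nonneg) auto

text \<open>Cross-multiplying two terms for the same signal cancels the products containing both 1 -
  \<beta> and 1 - \<open>\<beta>\<^sub>0\<close>, leaving the difference of the efforts as a
  factor.\<close>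

lemma critical_verification_diff:
  assumes "0 \<le> \<beta>\<^sub>0" "\<beta>\<^sub>0 < 1" "0 \<le> \<beta>" "\<beta> < 1"
  shows "critical_verification i \<beta> E - critical_verification i \<beta>\<^sub>0 E =
    - (\<beta> - \<beta>\<^sub>0) * (i * verification_slope \<beta>\<^sub>0 \<beta> E)"
proof -
  have aux: "(1 - \<beta>) * b\<^sup>2 / ((1 - \<beta>) * b + g) - (1 - \<beta>\<^sub>0) * b\<^sup>2 / ((1 - \<beta>\<^sub>0) * b + g) =
      - (\<beta> - \<beta>\<^sub>0) * (b\<^sup>2 * g / (((1 - \<beta>) * b + g) * ((1 - \<beta>\<^sub>0) * b + g)))"
    if "0 < (1 - \<beta>) * b + g" "0 < (1 - \<beta>\<^sub>0) * b + g" for b g :: real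
  proof -
    define m m0 where "m = (1 - \<beta>) * b + g" and "m0 = (1 - \<beta>\<^sub>0) * b + g"
    have "(1 - \<beta>) * b\<^sup>2 * m0 - (1 - \<beta>\<^sub>0) * b\<^sup>2 * m = - (\<beta> - \<beta>\<^sub>0) * (b\<^sup>2 * g)"
      by (simp add: m_def m0_def algebra_simps)
    moreover have "m \<noteq> 0" "m0 \<noteq> 0" using that by (auto simp: m_def m0_def)
    ultimately show ?thesis
      unfolding m_def[symmetric] m0_def[symmetric] by (simp add: diff_frac_eq)
  qed
  have "critical_verification i \<beta> E - critical_verification i \<beta>\<^sub>0 E =
      i * (- (\<beta> - \<beta>\<^sub>0) * verification_slope \<beta>\<^sub>0 \<beta> E)"
    using assms
    unfolding critical_verification_eq[OF assms(1) less_imp_le[OF assms(2)]]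
      critical_verification_eq[OF assms(3) less_imp_le[OF assms(4)]]
      right_diff_distrib[symmetric] sum_subtractf[symmetric] verification_slope_def
      sum_distrib_left[of "- (\<beta> - \<beta>\<^sub>0)"]
    by (intro arg_cong[where f = "\<lambda>t. i * t"] sum.cong refl aux weight_pos) auto
  then show ?thesis
    by simp
qed

text \<open>The interval stops short of 1 because a signal occurring only in the bad state has a
  term that is constant and positive below \<beta> = 1 but drops to zero there.\<close>

lemma continuous_on_critical_verification:
  assumes "u < 1"
  shows "continuous_on {0..u} (\<lambda>\<beta>. critical_verification i \<beta> E)"
proof -
  have "continuous_on {0..u} (\<lambda>\<beta>. i * (\<Sum>\<omega>\<in>signal_support E. (1 - \<beta>) * (pmf (E Bad) \<omega>)\<^sup>2 /
                                 ((1 - \<beta>) * pmf (E Bad) \<omega> + pmf (E Good) \<omega>)))"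
  proof (intro continuous_intros ballI)
    fix \<omega> \<beta> assume "\<omega> \<in> signal_support E" "\<beta> \<in> {0..u}"
    then show "(1 - \<beta>) * pmf (E Bad) \<omega> + pmf (E Good) \<omega> \<noteq> 0"
      using weight_pos[of \<omega> E "1 - \<beta>"] assms by simp
  qed
  then show ?thesis
    by (rule continuous_on_eq) (use assms in \<open>auto simp: critical_verification_eq\<close>)
qed

text \<open>The level never exceeds \<open>i\<close>, so the best response to any effort is at most
  \<open>l / 2 * i\<close>. Using this as right endpoint gives the sign change and stays below the
  discontinuity at 1.\<close>

lemma equilibrium_effort_exists:
  assumes fin: "finite (signal_support E)" and i: "0 \<le> i" and l: "0 \<le> l" and il: "l / 2 * i < 1"
  shows "\<exists>\<beta>. 0 \<le> \<beta> \<and> \<beta> \<le> l / 2 * i \<and> \<beta> = l / 2 * critical_verification i \<beta> E"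
proof -
  define u where "u = l / 2 * i"
  have u: "0 \<le> u" "u < 1" using i l il by (auto simp: u_def)
  define h where "h \<beta> = \<beta> - l / 2 * critical_verification i \<beta> E" for \<beta>
  have "\<exists>\<beta>\<ge>0. \<beta> \<le> u \<and> h \<beta> = 0"
  proof (rule IVT')
    show "h 0 \<le> 0"
      using critical_verification_bounds(1)[OF fin _ _ i, of 0] l by (simp add: h_def)
    show "0 \<le> h u"
      using critical_verification_bounds(2)[OF fin _ _ i, of u] u l
      by (simp add: h_def u_def mult_left_mono)
    show "continuous_on {0..u} h"
      unfolding h_def by (intro continuous_intros continuous_on_critical_verification u)
  qed (use u in auto)
  then show ?thesis
    by (auto simp: h_def u_def)
qed

text \<open>The level falls weakly in effort, so \<beta> minus the right-hand side is strictly
  increasing: the difference of two solutions is killed by a factor 1 + \<open>s\<close> with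
  \<open>s\<close> nonnegative.\<close>

lemma equilibrium_effort_unique:
  assumes i: "0 \<le> i" and l: "0 \<le> l"
    and "0 \<le> \<beta>" "\<beta> < 1" "\<beta> = l / 2 * critical_verification i \<beta> E"
    and "0 \<le> \<beta>'" "\<beta>' < 1" "\<beta>' = l / 2 * critical_verification i \<beta>' E"
  shows "\<beta> = \<beta>'"
proof -
  define s where "s = l / 2 * (i * verification_slope \<beta>' \<beta> E)"
  have s: "0 \<le> s"
    unfolding s_def using assms by (intro mult_nonneg_nonneg verification_slope_nonneg) auto
  have "\<beta> - \<beta>' = l / 2 * (critical_verification i \<beta> E - critical_verification i \<beta>' E)"
    using assms by (simp add: right_diff_distrib)
  also have "\<dots> = - (\<beta> - \<beta>') * s"
    using assms by (simp add: critical_verification_diff s_def)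
  finally have "(\<beta> - \<beta>') * (1 + s) = 0"
    by (simp add: algebra_simps)
  with s show ?thesis by simp
qed

lemma equilibrium_effort:
  assumes fin: "finite (signal_support E)" and i: "0 \<le> i" and l: "0 \<le> l" and il: "l / 2 * i < 1"
  shows "0 \<le> equilibrium_effort i l E" "equilibrium_effort i l E \<le> l / 2 * i"
    and "l / 2 * critical_verification i (equilibrium_effort i l E) E = equilibrium_effort i l E"
proof -
  obtain \<beta> where \<beta>: "0 \<le> \<beta>" "\<beta> \<le> l / 2 * i" "\<beta> = l / 2 * critical_verification i \<beta> E"
    using equilibrium_effort_exists[OF assms] by blast
  have "equilibrium_effort i l E = \<beta>"
    unfolding equilibrium_effort_def
  proof (rule the_equality)
    show "0 \<le> \<beta> \<and> \<beta> < 1 \<and> \<beta> = l / 2 * critical_verification i \<beta> E"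
      using \<beta> il by simp
    show "\<beta>' = \<beta>" if "0 \<le> \<beta>' \<and> \<beta>' < 1 \<and> \<beta>' = l / 2 * critical_verification i \<beta>' E" for \<beta>'
      using equilibrium_effort_unique[OF i l, of \<beta>' E \<beta>] that \<beta> il by simp
  qed
  with \<beta> show "0 \<le> equilibrium_effort i l E" "equilibrium_effort i l E \<le> l / 2 * i"
    "l / 2 * critical_verification i (equilibrium_effort i l E) E = equilibrium_effort i l E"
    by auto
qed

text \<open>If effort did not rise, the better signal at the old effort would raise the level
  strictly, and moving to the lower effort would not reduce it. The equilibrium equations would then
  make the new effort the larger one.\<close>

lemma equilibrium_effort_strict_mono:
  fixes E :: "'w info" and E' :: "'v info"
  assumes fin': "finite (signal_support E')" and fin: "finite (signal_support E)"
    and dom: "strictly_blackwell_dominates E' E"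
    and i: "0 < i" and l: "0 < l" and il: "l / 2 * i < 1"
  shows "equilibrium_effort i l E < equilibrium_effort i l E'"
proof (rule ccontr)
  define \<beta> \<beta>' where "\<beta> = equilibrium_effort i l E" and "\<beta>' = equilibrium_effort i l E'"
  assume "\<not> equilibrium_effort i l E < equilibrium_effort i l E'"
  then have le: "\<beta>' \<le> \<beta>" by (simp add: \<beta>_def \<beta>'_def)
  have \<beta>: "0 \<le> \<beta>" "\<beta> < 1" "l / 2 * critical_verification i \<beta> E = \<beta>"
    using equilibrium_effort[OF fin _ _ il] i l il by (auto simp: \<beta>_def)
  have \<beta>': "0 \<le> \<beta>'" "\<beta>' < 1" "l / 2 * critical_verification i \<beta>' E' = \<beta>'"
    using equilibrium_effort[OF fin' _ _ il] i l il by (auto simp: \<beta>'_def)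
  have "(\<beta> - \<beta>') * (i * verification_slope \<beta>' \<beta> E') \<ge> 0"
    using le i \<beta>(2) \<beta>'(2) by (intro mult_nonneg_nonneg verification_slope_nonneg) auto
  then have "critical_verification i \<beta> E' \<le> critical_verification i \<beta>' E'"
    using critical_verification_diff[OF \<beta>'(1,2) \<beta>(1,2), of i E'] by linarith
  moreover have "critical_verification i \<beta> E < critical_verification i \<beta> E'"
    by (rule critical_verification_strict_mono[OF fin' fin dom \<beta>(1,2) i])
  ultimately have "l / 2 * critical_verification i \<beta> E < l / 2 * critical_verification i \<beta>' E'"
    using l by simp
  with \<beta> \<beta>' le show False by simp
qed

section \<open>Convergence of the slope when the support varies\<close>

text \<open>The mass outside a finite set is one minus a finite sum, so pointwise convergence
  suffices even if new signals keep appearing.\<close>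

lemma tendsto_pmf_prob_Compl:
  fixes p :: "'b \<Rightarrow> 'w pmf" and p\<^sub>0 :: "'w pmf"
  assumes "\<And>\<omega>. ((\<lambda>q. pmf (p q) \<omega>) \<longlongrightarrow> pmf p\<^sub>0 \<omega>) F" and S: "finite S" "set_pmf p\<^sub>0 \<subseteq> S"
  shows "((\<lambda>q. measure_pmf.prob (p q) (- S)) \<longlongrightarrow> 0) F"
proof -
  have "((\<lambda>q. 1 - (\<Sum>\<omega>\<in>S. pmf (p q) \<omega>)) \<longlongrightarrow> 1 - (\<Sum>\<omega>\<in>S. pmf p\<^sub>0 \<omega>)) F"
    by (intro tendsto_intros assms)
  moreover have "measure_pmf.prob (p q) (- S) = 1 - (\<Sum>\<omega>\<in>S. pmf (p q) \<omega>)" for q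
    using measure_pmf.prob_compl[of S "p q"] S(1)
    by (simp add: measure_measure_pmf_finite Compl_eq_Diff_UNIV)
  ultimately show ?thesis
    by (simp add: sum_pmf_eq_1[OF S])
qed

text \<open>A bound linear in \<open>b\<close> and free of \<open>g\<close> and \<open>y\<close>:
  summed over the signals outside the base support, it is controlled by their probability in the bad
  state.\<close>

lemma slope_term_le:
  fixes x y b g :: real
  assumes "0 < x" "0 < y" "0 \<le> b" "0 \<le> g"
  shows "b\<^sup>2 * g / ((x * b + g) * (y * b + g)) \<le> b / x"
\<comment> \<open>With \<open>b\<close> and \<open>g\<close> both zero the denominators vanish, so
  this case is separate.\<close>
proof (cases "b = 0")
  case False
  then have b: "0 < b" using assms by simp
  have p: "0 < x * b + g" "0 < y * b + g"
    using assms b by (simp_all add: add_pos_nonneg)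
  have "b\<^sup>2 * g / ((x * b + g) * (y * b + g)) = b / (x * b + g) * b * (g / (y * b + g))"
    by (simp add: power2_eq_square)
  also have "\<dots> \<le> 1 / x * b * 1"
  proof (intro mult_mono)
    show "b / (x * b + g) \<le> 1 / x" using assms p by (simp add: field_simps)
    show "g / (y * b + g) \<le> 1" using assms p by simp
  qed (use assms p in auto)
  finally show ?thesis by simp
qed simp

text \<open>On the base support the sum is finite with a fixed index set and converges termwise; the
  remaining signals contribute at most their vanishing mass over 1 - \<beta>.\<close>

lemma tendsto_verification_slope:
  fixes E :: "'b \<Rightarrow> 'w info" and E\<^sub>0 :: "'w info"
  assumes lim: "\<And>\<theta> \<omega>. ((\<lambda>q. pmf (E q \<theta>) \<omega>) \<longlongrightarrow> pmf (E\<^sub>0 \<theta>) \<omega>) F"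
    and \<beta>: "(\<beta> \<longlongrightarrow> \<beta>\<^sub>0) F" "\<beta>\<^sub>0 < 1"
    and fin: "\<forall>\<^sub>F q in F. finite (signal_support (E q))" and fin0: "finite (signal_support E\<^sub>0)"
  shows "((\<lambda>q. verification_slope \<beta>\<^sub>0 (\<beta> q) (E q)) \<longlongrightarrow> verification_slope \<beta>\<^sub>0 \<beta>\<^sub>0 E\<^sub>0) F"
proof -
  define S where "S = signal_support E\<^sub>0"
  define t where "t q \<omega> = (pmf (E q Bad) \<omega>)\<^sup>2 * pmf (E q Good) \<omega> /
        (((1 - \<beta> q) * pmf (E q Bad) \<omega> + pmf (E q Good) \<omega>) *
         ((1 - \<beta>\<^sub>0) * pmf (E q Bad) \<omega> + pmf (E q Good) \<omega>))" for q \<omega>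
  define P where "P q = measure_pmf.prob (E q Bad) (- S)" for q
  have main: "((\<lambda>q. \<Sum>\<omega>\<in>S. t q \<omega>) \<longlongrightarrow> verification_slope \<beta>\<^sub>0 \<beta>\<^sub>0 E\<^sub>0) F"
    unfolding verification_slope_def t_def S_def
    by (intro tendsto_intros lim \<beta>(1))
       (use \<beta>(2) in \<open>auto dest!: weight_pos[where x = "1 - \<beta>\<^sub>0"]\<close>)
  have "(P \<longlongrightarrow> 0) F"
    unfolding P_def using lim fin0 set_pmf_subset_signal_support[of E\<^sub>0 Bad]
    by (intro tendsto_pmf_prob_Compl[where p\<^sub>0 = "E\<^sub>0 Bad"]) (auto simp: S_def)
  then have "((\<lambda>q. P q / (1 - \<beta> q)) \<longlongrightarrow> 0 / (1 - \<beta>\<^sub>0)) F"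
    using \<beta> by (intro tendsto_intros) auto
  then have tail: "((\<lambda>q. P q / (1 - \<beta> q)) \<longlongrightarrow> 0) F"
    by simp
  have "\<forall>\<^sub>F q in F. \<beta> q < 1"
    using \<beta> by (rule order_tendstoD)
  with fin have ev: "\<forall>\<^sub>F q in F. norm (verification_slope \<beta>\<^sub>0 (\<beta> q) (E q) - (\<Sum>\<omega>\<in>S. t q \<omega>))
      \<le> P q / (1 - \<beta> q)"
  proof eventually_elim
    case (elim q)
    define T where "T = signal_support (E q)"
    have finT: "finite T" using elim by (simp add: T_def)
    have t0: "t q \<omega> \<ge> 0" for \<omega>
      unfolding t_def using elim \<beta>(2)
      by (intro divide_nonneg_nonneg mult_nonneg_nonneg add_nonneg_nonneg) auto
    \<comment> \<open>Base signals that are absent at \<open>q\<close> have numerator zero, so they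
      may be added to the index set.\<close>
    have out: "t q \<omega> = 0" if "\<omega> \<notin> T" for \<omega>
      using that by (auto simp: t_def T_def signal_support_def set_pmf_iff)
    have "verification_slope \<beta>\<^sub>0 (\<beta> q) (E q) = (\<Sum>\<omega>\<in>T. t q \<omega>)"
      by (simp add: verification_slope_def t_def T_def)
    also have "\<dots> = (\<Sum>\<omega>\<in>S \<union> (T - S). t q \<omega>)"
      using finT fin0 out by (intro sum.mono_neutral_left) (auto simp: S_def)
    also have "\<dots> = (\<Sum>\<omega>\<in>S. t q \<omega>) + (\<Sum>\<omega>\<in>T - S. t q \<omega>)"
      using finT fin0 by (intro sum.union_disjoint) (auto simp: S_def)
    finally have "norm (verification_slope \<beta>\<^sub>0 (\<beta> q) (E q) - (\<Sum>\<omega>\<in>S. t q \<omega>)) = (\<Sum>\<omega>\<in>T - S. t q \<omega>)"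
      using t0 by (simp add: sum_nonneg)
    also have "\<dots> \<le> (\<Sum>\<omega>\<in>T - S. pmf (E q Bad) \<omega> / (1 - \<beta> q))"
      unfolding t_def using elim \<beta>(2) by (intro sum_mono slope_term_le) auto
    also have "\<dots> = measure_pmf.prob (E q Bad) (T - S) / (1 - \<beta> q)"
      using finT by (simp add: measure_measure_pmf_finite sum_divide_distrib)
    also have "\<dots> \<le> P q / (1 - \<beta> q)"
      unfolding P_def using elim
      by (intro divide_right_mono measure_pmf.finite_measure_mono) auto
    finally show ?case .
  qed
  have "((\<lambda>q. verification_slope \<beta>\<^sub>0 (\<beta> q) (E q) - (\<Sum>\<omega>\<in>S. t q \<omega>)) \<longlongrightarrow> 0) F"
    by (rule Lim_null_comparison[OF ev tail])
  from tendsto_add[OF this main] show ?thesis by simp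
qed

section \<open>Derivatives along the signal family\<close>

lemma equilibrium_effort_has_derivative:
  fixes \<pi> :: "real \<Rightarrow> 'w info"
  assumes fin: "\<And>q. q \<in> A \<Longrightarrow> finite (signal_support (\<pi> q))"
    and cont: "\<And>\<theta> \<omega>. continuous_on A (\<lambda>q. pmf (\<pi> q \<theta>) \<omega>)"
    and i: "0 \<le> i" and l: "0 \<le> l" and il: "l / 2 * i < 1"
    and q0: "q\<^sub>0 \<in> A" and \<beta>\<^sub>0: "\<beta>\<^sub>0 = equilibrium_effort i l (\<pi> q\<^sub>0)"
    and D: "((\<lambda>q. critical_verification i \<beta>\<^sub>0 (\<pi> q)) has_real_derivative D) (at q\<^sub>0 within A)"
  shows "((\<lambda>q. equilibrium_effort i l (\<pi> q)) has_real_derivative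
    l / 2 * D / (1 + l / 2 * (i * verification_slope \<beta>\<^sub>0 \<beta>\<^sub>0 (\<pi> q\<^sub>0)))) (at q\<^sub>0 within A)"
proof -
  let ?F = "at q\<^sub>0 within A"
  define \<beta> where "\<beta> q = equilibrium_effort i l (\<pi> q)" for q
  define c where "c q = critical_verification i \<beta>\<^sub>0 (\<pi> q)" for q
  define s where "s q = l / 2 * (i * verification_slope \<beta>\<^sub>0 (\<beta> q) (\<pi> q))" for q
  have \<beta>0: "\<beta>\<^sub>0 = \<beta> q\<^sub>0" by (simp add: \<beta>_def \<beta>\<^sub>0)
  have eff: "0 \<le> \<beta> q" "\<beta> q < 1" "l / 2 * critical_verification i (\<beta> q) (\<pi> q) = \<beta> q"
    if "q \<in> A" for q
    using equilibrium_effort[OF fin[OF that] i l il] il by (auto simp: \<beta>_def)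
  have s_nonneg: "0 \<le> s q" if "q \<in> A" for q
    unfolding s_def using eff[OF that] eff[OF q0] i l \<beta>0
    by (intro mult_nonneg_nonneg verification_slope_nonneg) auto
  \<comment> \<open>The increment splits into a change of effort at the new signal and a change of
    signal at the old effort. The former is a multiple of the increment itself and moves to the
    left-hand side.\<close>
  have key: "\<beta> q - \<beta>\<^sub>0 = l / 2 * (c q - c q\<^sub>0) / (1 + s q)" if q: "q \<in> A" for q
  proof -
    have "\<beta> q - \<beta>\<^sub>0 = l / 2 * (critical_verification i (\<beta> q) (\<pi> q) - c q) + l / 2 * (c q - c q\<^sub>0)"
      using eff(3)[OF q] eff(3)[OF q0] by (simp add: c_def \<beta>0 right_diff_distrib)
    also have "l / 2 * (critical_verification i (\<beta> q) (\<pi> q) - c q) = - (\<beta> q - \<beta>\<^sub>0) * s q"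
      using eff[OF q] eff[OF q0] by (simp add: c_def s_def \<beta>0 critical_verification_diff)
    finally have "(\<beta> q - \<beta>\<^sub>0) * (1 + s q) = l / 2 * (c q - c q\<^sub>0)"
      by (simp add: algebra_simps)
    then show ?thesis
      using s_nonneg[OF q] by (subst nonzero_eq_divide_eq) auto
  qed
  have inA: "\<forall>\<^sub>F q in ?F. q \<in> A"
    by (simp add: eventually_at_filter)
  \<comment> \<open>Convergence of \<open>s\<close> relies on continuity of the effort, so
    continuity comes first: as \<open>s\<close> is nonnegative, dropping the denominator in
    \<open>key\<close> bounds the increment by that of \<open>c\<close>.\<close>
  have c_lim: "(c \<longlongrightarrow> c q\<^sub>0) ?F"
    using DERIV_continuous[OF D] by (simp add: c_def[abs_def] continuous_within)
  have "((\<lambda>q. l / 2 * (c q - c q\<^sub>0)) \<longlongrightarrow> l / 2 * (c q\<^sub>0 - c q\<^sub>0)) ?F"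
    by (intro tendsto_intros c_lim)
  then have "((\<lambda>q. norm (l / 2 * (c q - c q\<^sub>0))) \<longlongrightarrow> 0) ?F"
    by (intro tendsto_norm_zero) simp
  then have "((\<lambda>q. \<beta> q - \<beta>\<^sub>0) \<longlongrightarrow> 0) ?F"
  proof (rule Lim_null_comparison[rotated])
    show "\<forall>\<^sub>F q in ?F. norm (\<beta> q - \<beta>\<^sub>0) \<le> norm (l / 2 * (c q - c q\<^sub>0))"
      using inA
    proof eventually_elim
      case (elim q)
      show ?case
        unfolding key[OF elim] using s_nonneg[OF elim]
        by (auto simp: divide_le_eq intro!: mult_left_mono)
    qed
  qed
  then have \<beta>_lim: "(\<beta> \<longlongrightarrow> \<beta>\<^sub>0) ?F"
    by (simp add: LIM_zero_iff)
  have "((\<lambda>q. verification_slope \<beta>\<^sub>0 (\<beta> q) (\<pi> q)) \<longlongrightarrow> verification_slope \<beta>\<^sub>0 \<beta>\<^sub>0 (\<pi> q\<^sub>0)) ?F"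
  proof (rule tendsto_verification_slope[OF _ \<beta>_lim])
    show "((\<lambda>q. pmf (\<pi> q \<theta>) \<omega>) \<longlongrightarrow> pmf (\<pi> q\<^sub>0 \<theta>) \<omega>) ?F" for \<theta> \<omega>
      using cont q0 by (simp add: continuous_on_def)
    show "\<forall>\<^sub>F q in ?F. finite (signal_support (\<pi> q))"
      using inA by eventually_elim (rule fin)
  qed (use eff[OF q0] fin[OF q0] \<beta>0 in auto)
  then have s_lim: "(s \<longlongrightarrow> s q\<^sub>0) ?F"
    unfolding s_def \<beta>0[symmetric] by (intro tendsto_intros)
  have "((\<lambda>q. (c q - c q\<^sub>0) / (q - q\<^sub>0)) \<longlongrightarrow> D) ?F"
    using D by (simp add: has_field_derivative_iff c_def)
  then have "((\<lambda>q. l / 2 * ((c q - c q\<^sub>0) / (q - q\<^sub>0)) / (1 + s q)) \<longlongrightarrow> l / 2 * D / (1 + s q\<^sub>0)) ?F"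
    using s_nonneg[OF q0] by (intro tendsto_intros s_lim) auto
  then have "((\<lambda>q. (\<beta> q - \<beta> q\<^sub>0) / (q - q\<^sub>0)) \<longlongrightarrow> l / 2 * D / (1 + s q\<^sub>0)) ?F"
  proof (rule Lim_transform_eventually)
    show "\<forall>\<^sub>F q in ?F. l / 2 * ((c q - c q\<^sub>0) / (q - q\<^sub>0)) / (1 + s q) = (\<beta> q - \<beta> q\<^sub>0) / (q - q\<^sub>0)"
      using inA by eventually_elim (simp add: key \<beta>0[symmetric] algebra_simps)
  qed
  then show ?thesis
    by (simp add: has_field_derivative_iff \<beta>_def s_def \<beta>\<^sub>0)
qed

text \<open>Continuity of the family gives no differentiability in q, and a strictly increasing
  function may have derivative zero. Hence the increases are stated as strict monotonicity, and
  positive derivatives are deduced wherever the partial derivative in q at the equilibrium effort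
  exists and is positive.\<close>

theorem proposition2:
  fixes I c L k i l :: real
    and \<pi> :: "real \<Rightarrow> 'w info"
    and abar :: "real \<Rightarrow> real \<Rightarrow> real"
    and \<beta>\<^sub>J :: "real \<Rightarrow> real"
  assumes "0 < I" "I < c" "0 < L" "L < k"
    and "i = I / c" "l = L / k"
    and "nested_signal_family \<pi>"
    and abar: "abar = (\<lambda>\<beta> q. critical_verification i \<beta> (\<pi> q))"
    and effort: "\<beta>\<^sub>J = (\<lambda>q. equilibrium_effort i l (\<pi> q))"
  shows "(\<forall>\<beta>\<in>{0..<1}. strict_mono_on {0..1} (abar \<beta>))
    \<and> strict_mono_on {0..1} \<beta>\<^sub>J
    \<and> strict_mono_on {0..1} (\<lambda>q. abar (\<beta>\<^sub>J q) q)
    \<and> (\<forall>q\<in>{0..1}. \<forall>D>0.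
         (abar (\<beta>\<^sub>J q) has_real_derivative D) (at q within {0..1}) \<longrightarrow>
           (\<exists>D'>0. (\<beta>\<^sub>J has_real_derivative D') (at q within {0..1})) \<and>
           (\<exists>D'>0. ((\<lambda>p. abar (\<beta>\<^sub>J p) p) has_real_derivative D') (at q within {0..1})))"
proof -
  have i: "0 < i" "i < 1" and l: "0 < l" "l < 1"
    using assms(1-6) by (simp_all add: divide_less_eq_1)
  have "l * i < 1"
    using i l mult_strict_mono[of l 1 i 1] by simp
  then have il: "l / 2 * i < 1"
    using i l by simp
  have fin: "finite (signal_support (\<pi> q))" if "q \<in> {0..1}" for q
    using assms(7) that by (simp add: nested_signal_family_def)
  have dom: "strictly_blackwell_dominates (\<pi> q') (\<pi> q)" if "q \<in> {0..1}" "q' \<in> {0..1}" "q < q'" for q q'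
    using assms(7) that unfolding nested_signal_family_def by blast
  have cont: "continuous_on {0..1} (\<lambda>q. pmf (\<pi> q \<theta>) \<omega>)" for \<theta> \<omega>
    using assms(7) unfolding nested_signal_family_def by blast
  have eff: "0 \<le> \<beta>\<^sub>J q" "\<beta>\<^sub>J q < 1" "abar (\<beta>\<^sub>J q) q = 2 / l * \<beta>\<^sub>J q" if "q \<in> {0..1}" for q
  proof -
    note e = equilibrium_effort[OF fin[OF that] less_imp_le[OF i(1)] less_imp_le[OF l(1)] il]
    show "0 \<le> \<beta>\<^sub>J q" "\<beta>\<^sub>J q < 1"
      using e(1,2) il by (auto simp: effort)
    \<comment> \<open>Read backwards, the equilibrium equation makes the level a positive multiple
      of the effort, so the third claim reduces to the second.\<close>
    show "abar (\<beta>\<^sub>J q) q = 2 / l * \<beta>\<^sub>J q"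
      using e(3) l by (simp add: effort abar field_simps)
  qed
  have mono_abar: "strict_mono_on {0..1} (abar \<beta>)" if "\<beta> \<in> {0..<1}" for \<beta>
    unfolding abar using that i
    by (intro strict_mono_onI critical_verification_strict_mono fin dom) auto
  have mono_effort: "strict_mono_on {0..1} \<beta>\<^sub>J"
    unfolding effort using i l il
    by (intro strict_mono_onI equilibrium_effort_strict_mono fin dom) auto
  have mono_level: "strict_mono_on {0..1} (\<lambda>q. abar (\<beta>\<^sub>J q) q)"
  proof (rule strict_mono_onI)
    fix q q' :: real assume q: "q \<in> {0..1}" "q' \<in> {0..1}" "q < q'"
    then have "\<beta>\<^sub>J q < \<beta>\<^sub>J q'"
      by (rule strict_mono_onD[OF mono_effort])
    then show "abar (\<beta>\<^sub>J q) q < abar (\<beta>\<^sub>J q') q'"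
      using l q by (simp add: eff divide_strict_right_mono)
  qed
  have deriv: "(\<exists>D'>0. (\<beta>\<^sub>J has_real_derivative D') (at q within {0..1})) \<and>
      (\<exists>D'>0. ((\<lambda>p. abar (\<beta>\<^sub>J p) p) has_real_derivative D') (at q within {0..1}))"
    if q: "q \<in> {0..1}" and "0 < D" and D: "(abar (\<beta>\<^sub>J q) has_real_derivative D) (at q within {0..1})"
    for q D
  proof -
    define D' where "D' = l / 2 * D / (1 + l / 2 * (i * verification_slope (\<beta>\<^sub>J q) (\<beta>\<^sub>J q) (\<pi> q)))"
    have "0 \<le> l / 2 * (i * verification_slope (\<beta>\<^sub>J q) (\<beta>\<^sub>J q) (\<pi> q))"
      using i l eff[OF q] by (intro mult_nonneg_nonneg verification_slope_nonneg) auto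
    then have D'_pos: "0 < D'"
      unfolding D'_def using l \<open>0 < D\<close> by (intro divide_pos_pos mult_pos_pos) auto
    have D': "(\<beta>\<^sub>J has_real_derivative D') (at q within {0..1})"
      unfolding effort D'_def
      by (rule equilibrium_effort_has_derivative)
         (use fin cont i l il q D in \<open>auto simp: effort abar\<close>)
    have "((\<lambda>p. 2 / l * \<beta>\<^sub>J p) has_real_derivative 2 / l * D') (at q within {0..1})"
      by (rule DERIV_cmult[OF D'])
    \<comment> \<open>The proportionality is available on [0,1] only, so the derivative is
      transferred within that set; the radius 1 is arbitrary.\<close>
    then have "((\<lambda>p. abar (\<beta>\<^sub>J p) p) has_real_derivative 2 / l * D') (at q within {0..1})"
      by (rule has_field_derivative_transform_within[OF _ zero_less_one q]) (simp add: eff)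
    moreover have "0 < 2 / l * D'"
      using l D'_pos by simp
    ultimately show ?thesis
      using D' D'_pos by blast
  qed
  show ?thesis
    using mono_abar mono_effort mono_level deriv by blast
qed

end
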